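(* Let $n\ge 2$ and $|q_{ij}|=1$ for $1\le i,j\le n$. Then $\bigoplus_{m=0}^{\infty}(\mathbb{C}^n)^{(q,m)}=\Gamma_q(\mathbb{C}^n)$ as subspaces of the full Fock space $\Gamma(\mathbb{C}^n)$, where $(\mathbb{C}^n)^{(q,m)}$ is the space of vectors in $(\mathbb{C}^n)^{\otimes m}$ fixed by all the operators $U^{m,q}_\sigma$, $\sigma\in\mathcal{S}_m$.
   Context: Fix complex numbers $(q_{ij})_{1\le i,j\le n}$ with $|q_{ij}|=1$, $q_{ii}=1$ and $q_{ji}=q_{ij}^{-1}=\overline{q_{ij}}$. Let $\{e_1,\ldots,e_n\}$ be the standard orthonormal basis of $\mathbb{C}^n$ and $\mathcal{S}_m$ the group of permutations of $\{1,\ldots,m\}$. For $\sigma\in\mathcal{S}_m$ and $x=(x_1,\ldots,x_m)\in\{1,\ldots,n\}^m$ put $q^\sigma(x)=\prod q_{x_{\sigma^{-1}(i)}x_{\sigma^{-1}(k)}}$, the product over pairs $(i,k)$ with $1\le i<k\le m$ and $\sigma^{-1}(i)>\sigma^{-1}(k)$. (It is the scalar for which $T_{x_1}\cdots T_{x_m}=q^\sigma(x)T_{x_{\sigma^{-1}(1)}}\cdots T_{x_{\sigma^{-1}(m)}}$ is obtained by successively applying the relations $T_jT_i=q_{ij}T_iT_j$ to adjacent factors.) Let $U^{m,q}_\sigma$ be the unitary operator on $(\mathbb{C}^n)^{\otimes m}$ that is the linear extension of $U^{m,q}_\sigma(e_{x_1}\otimes\cdots\otimes e_{x_m})=q^\sigma(x)\,e_{x_{\sigma^{-1}(1)}}\otimes\cdots\otimes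 e_{x_{\sigma^{-1}(m)}}$. Set $(\mathbb{C}^n)^{(q,m)}=\{u\in(\mathbb{C}^n)^{\otimes m}:U^{m,q}_\sigma u=u\ \forall\sigma\in\mathcal{S}_m\}$ and $(\mathbb{C}^n)^{(q,0)}=\mathbb{C}$. Let $\Gamma(\mathbb{C}^n)=\bigoplus_{m\ge0}(\mathbb{C}^n)^{\otimes m}$ be the full Fock space with vacuum $\omega$ and left creation operators $V_ix=e_i\otimes x$ (with $e_i\otimes\omega=e_i$), $\underline V=(V_1,\ldots,V_n)$. For an $n$-tuple $\underline{R}$ of bounded operators on a Hilbert space $\mathcal{M}$, let $\mathcal{M}^q(\underline{R})$ be the largest closed subspace $\mathcal{N}\subseteq\mathcal{M}$ such that every $R_i^*$ leaves $\mathcal{N}$ invariant and $R_i^*R_j^*h=\overline{q_{ij}}R_j^*R_i^*h$ for all $h\in\mathcal{N}$ and all $i,j$ (it exists). The $q$-commuting Fock space is $\Gamma_q(\mathbb{C}^n)=(\Gamma(\mathbb{C}^n))^q(\underline{V})$. The direct sum is the Hilbert space direct sum. *)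

theory Defs
  imports "HOL-Analysis.Analysis" "HOL-Combinatorics.Permutations"
begin

section \<open>Complex Hilbert spaces\<close>

text \<open>Norm and topology are those of the underlying real Hilbert space, whose real inner product is
  the real part of the sesquilinear form \<^term>\<open>cinner\<close> (linear in the second argument).\<close>

class scaleC =
  fixes scaleC :: "complex \<Rightarrow> 'a \<Rightarrow> 'a" (infixr \<open>*\<^sub>C\<close> 75)

class complex_hilbert = real_inner + complete_space + scaleC +
  fixes cinner :: "'a \<Rightarrow> 'a \<Rightarrow> complex"
  assumes scaleC_add_right: "c *\<^sub>C (x + y) = c *\<^sub>C x + c *\<^sub>C y"
    and scaleC_add_left: "(c + d) *\<^sub>C x = c *\<^sub>C x + d *\<^sub>C x"
    and scaleC_scaleC: "c *\<^sub>C d *\<^sub>C x = (c * d) *\<^sub>C x"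
    and scaleR_scaleC: "r *\<^sub>R x = of_real r *\<^sub>C x"
    and cinner_commute: "cinner x y = cnj (cinner y x)"
    and cinner_add_right: "cinner x (y + z) = cinner x y + cinner x z"
    and cinner_scaleC_right: "cinner x (c *\<^sub>C y) = c * cinner x y"
    and inner_eq_Re_cinner: "inner x y = Re (cinner x y)"

global_interpretation complex_vector: vector_space "scaleC :: complex \<Rightarrow> 'a \<Rightarrow> 'a::complex_hilbert"
proof
  fix c d :: complex and x y :: 'a
  show "c *\<^sub>C (x + y) = c *\<^sub>C x + c *\<^sub>C y" by (rule scaleC_add_right)
  show "(c + d) *\<^sub>C x = c *\<^sub>C x + d *\<^sub>C x" by (rule scaleC_add_left)
  show "c *\<^sub>C d *\<^sub>C x = (c * d) *\<^sub>C x" by (rule scaleC_scaleC)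
  show "1 *\<^sub>C x = x" using scaleR_scaleC[of 1 x] by simp
qed

definition cadjoint :: "('a::complex_hilbert \<Rightarrow> 'b::complex_hilbert) \<Rightarrow> 'b \<Rightarrow> 'a"
  where "cadjoint F = (SOME G. \<forall>x y. cinner (F x) y = cinner x (G y))"

lemma cinner_ext:
  fixes a b :: "'a::complex_hilbert"
  assumes "\<And>x. cinner x a = cinner x b"
  shows "a = b"
proof -
  have "inner x a = inner x b" for x
    using assms by (simp add: inner_eq_Re_cinner)
  then have "inner x (a - b) = 0" for x by (simp add: inner_diff_right)
  then show ?thesis by (metis inner_eq_zero_iff eq_iff_diff_eq_0)
qed

lemma cadjoint_eqI:
  assumes "\<And>x y. cinner (F x) y = cinner x (G y)"
  shows "cadjoint F = G"
proof -
  have "\<forall>x y. cinner (F x) y = cinner x (cadjoint F y)"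
    unfolding cadjoint_def by (rule someI[of _ G]) (use assms in blast)
  then show ?thesis using assms by (intro ext cinner_ext) metis
qed

text \<open>The Hilbert space direct sum of mutually orthogonal closed subspaces, as a subspace of the
  ambient space: a square-summable family is identified with the (then convergent) sum of its
  members.\<close>

definition hilbert_direct_sum :: "(nat \<Rightarrow> 'a::complex_hilbert set) \<Rightarrow> 'a set"
  where "hilbert_direct_sum H =
    {u. \<exists>h. (\<forall>m. h m \<in> H m) \<and> summable (\<lambda>m. (norm (h m))\<^sup>2) \<and> h sums u}"


section \<open>Maximal q-commuting subspaces\<close>

definition is_q_commuting_on ::
    "('n \<Rightarrow> 'n \<Rightarrow> complex) \<Rightarrow> ('n \<Rightarrow> 'a \<Rightarrow> 'a) \<Rightarrow> 'a::complex_hilbert set \<Rightarrow> bool"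
  where "is_q_commuting_on q R N \<longleftrightarrow>
    complex_vector.subspace N \<and> closed N \<and>
    (\<forall>i. \<forall>h\<in>N. cadjoint (R i) h \<in> N) \<and>
    (\<forall>h\<in>N. \<forall>i j. cadjoint (R i) (cadjoint (R j) h) =
       cnj (q i j) *\<^sub>C cadjoint (R j) (cadjoint (R i) h))"

text \<open>To be used for tuples \<^term>\<open>R\<close> of bounded complex-linear operators only. The order on sets is
  inclusion.\<close>

definition max_q_commuting ::
    "('n \<Rightarrow> 'n \<Rightarrow> complex) \<Rightarrow> ('n \<Rightarrow> 'a \<Rightarrow> 'a) \<Rightarrow> 'a::complex_hilbert set"
  where "max_q_commuting q R = (GREATEST N. is_q_commuting_on q R N)"


section \<open>Square-summable functions\<close>

typedef 'a ell2 = "{f :: 'a \<Rightarrow> complex. (\<lambda>a. (cmod (f a))\<^sup>2) summable_on UNIV}"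
  morphisms coeff Abs_ell2
  by (rule exI[of _ "\<lambda>_. 0"]) simp

setup_lifting type_definition_ell2

lemma ell2_eqI: "(\<And>a. coeff x a = coeff y a) \<Longrightarrow> x = y"
  by (metis coeff_inject ext)

lemma coeff_summable: "(\<lambda>a. (cmod (coeff x a))\<^sup>2) summable_on UNIV"
  using coeff[of x] by simp

lemma sq_summable_add:
  assumes "(\<lambda>a. (cmod (f a))\<^sup>2) summable_on UNIV" "(\<lambda>a. (cmod (g a))\<^sup>2) summable_on UNIV"
  shows "(\<lambda>a. (cmod (f a + g a))\<^sup>2) summable_on UNIV"
proof (rule summable_on_comparison_test)
  show "(\<lambda>a. 2 * (cmod (f a))\<^sup>2 + 2 * (cmod (g a))\<^sup>2) summable_on UNIV"
    by (intro summable_on_add summable_on_cmult_right assms)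
  fix a
  have "(cmod (f a + g a))\<^sup>2 \<le> (cmod (f a) + cmod (g a))\<^sup>2"
    by (intro power_mono norm_triangle_ineq) auto
  also have "\<dots> \<le> 2 * (cmod (f a))\<^sup>2 + 2 * (cmod (g a))\<^sup>2"
    using sum_squares_bound[of "cmod (f a)" "cmod (g a)"] by (simp add: power2_sum)
  finally show "(cmod (f a + g a))\<^sup>2 \<le> 2 * (cmod (f a))\<^sup>2 + 2 * (cmod (g a))\<^sup>2" .
qed auto

lemma sq_summable_cmult:
  assumes "(\<lambda>a. (cmod (f a))\<^sup>2) summable_on UNIV"
  shows "(\<lambda>a. (cmod (c * f a))\<^sup>2) summable_on UNIV"
  using summable_on_cmult_right[OF assms, of "(cmod c)\<^sup>2"]
  by (simp add: norm_mult power_mult_distrib)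

lemma sq_summable_mult:
  assumes "(\<lambda>a. (cmod (f a))\<^sup>2) summable_on UNIV" "(\<lambda>a. (cmod (g a))\<^sup>2) summable_on UNIV"
  shows "(\<lambda>a. cnj (f a) * g a) summable_on UNIV"
proof (rule abs_summable_summable, rule summable_on_comparison_test)
  show "(\<lambda>a. (cmod (f a))\<^sup>2 + (cmod (g a))\<^sup>2) summable_on UNIV"
    by (intro summable_on_add assms)
  fix a
  have "0 \<le> cmod (f a) * cmod (g a)" by simp
  moreover have "2 * (cmod (f a) * cmod (g a)) \<le> (cmod (f a))\<^sup>2 + (cmod (g a))\<^sup>2"
    using sum_squares_bound[of "cmod (f a)" "cmod (g a)"] by (simp add: mult.assoc)
  ultimately show "cmod (cnj (f a) * g a) \<le> (cmod (f a))\<^sup>2 + (cmod (g a))\<^sup>2"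
    unfolding norm_mult complex_mod_cnj by linarith
qed auto

instantiation ell2 :: (type) "{real_vector, scaleC}"
begin
lift_definition zero_ell2 :: "'a ell2" is "\<lambda>_. 0" by simp
lift_definition plus_ell2 :: "'a ell2 \<Rightarrow> 'a ell2 \<Rightarrow> 'a ell2" is "\<lambda>f g a. f a + g a"
  by (rule sq_summable_add)
lift_definition uminus_ell2 :: "'a ell2 \<Rightarrow> 'a ell2" is "\<lambda>f a. - f a" by simp
lift_definition minus_ell2 :: "'a ell2 \<Rightarrow> 'a ell2 \<Rightarrow> 'a ell2" is "\<lambda>f g a. f a - g a"
  using sq_summable_add[of _ "\<lambda>a. - _ a"] by fastforce
lift_definition scaleC_ell2 :: "complex \<Rightarrow> 'a ell2 \<Rightarrow> 'a ell2" is "\<lambda>c f a. c * f a"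
  by (rule sq_summable_cmult)
lift_definition scaleR_ell2 :: "real \<Rightarrow> 'a ell2 \<Rightarrow> 'a ell2" is "\<lambda>r f a. of_real r * f a"
  by (rule sq_summable_cmult)
instance by standard (transfer; simp add: algebra_simps)+
end

lemmas coeff_simps [simp] = zero_ell2.rep_eq plus_ell2.rep_eq uminus_ell2.rep_eq minus_ell2.rep_eq
  scaleC_ell2.rep_eq scaleR_ell2.rep_eq

definition ell2_cinner :: "'a ell2 \<Rightarrow> 'a ell2 \<Rightarrow> complex"
  where "ell2_cinner x y = (\<Sum>\<^sub>\<infinity>a. cnj (coeff x a) * coeff y a)"

lemma ell2_cinner_summable: "(\<lambda>a. cnj (coeff x a) * coeff y a) summable_on UNIV"
  by (intro sq_summable_mult coeff_summable)

lemma ell2_cinner_commute: "ell2_cinner x y = cnj (ell2_cinner y x)"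
  unfolding ell2_cinner_def by (simp flip: infsum_cnj add: mult.commute)

lemma ell2_cinner_add_right: "ell2_cinner x (y + z) = ell2_cinner x y + ell2_cinner x z"
  unfolding ell2_cinner_def
  by (simp add: distrib_left infsum_add ell2_cinner_summable)

lemma ell2_cinner_scaleC_right: "ell2_cinner x (c *\<^sub>C y) = c * ell2_cinner x y"
  unfolding ell2_cinner_def
  by (simp add: ell2_cinner_summable mult.left_commute flip: infsum_cmult_right')

lemma ell2_cinner_self: "ell2_cinner x x = of_real (\<Sum>\<^sub>\<infinity>a. (cmod (coeff x a))\<^sup>2)"
proof -
  have "((\<lambda>a. complex_of_real ((cmod (coeff x a))\<^sup>2)) has_sum
      of_real (\<Sum>\<^sub>\<infinity>a. (cmod (coeff x a))\<^sup>2)) UNIV"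
    by (intro has_sum_of_real has_sum_infsum coeff_summable)
  moreover have "of_real ((cmod z)\<^sup>2) = cnj z * z" for z
    by (simp only: complex_norm_square mult.commute)
  ultimately show ?thesis unfolding ell2_cinner_def by (simp only: infsumI)
qed

instantiation ell2 :: (type) real_inner
begin
definition inner_ell2 :: "'a ell2 \<Rightarrow> 'a ell2 \<Rightarrow> real" where "inner_ell2 x y = Re (ell2_cinner x y)"
definition norm_ell2 :: "'a ell2 \<Rightarrow> real" where "norm_ell2 x = sqrt (inner x x)"
definition sgn_ell2 :: "'a ell2 \<Rightarrow> 'a ell2" where "sgn_ell2 x = x /\<^sub>R norm x"
definition dist_ell2 :: "'a ell2 \<Rightarrow> 'a ell2 \<Rightarrow> real" where "dist_ell2 x y = norm (x - y)"
definition uniformity_ell2 :: "('a ell2 \<times> 'a ell2) filter"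
  where "uniformity_ell2 = (INF e\<in>{0<..}. principal {(x, y). dist x y < e})"
definition open_ell2 :: "'a ell2 set \<Rightarrow> bool"
  where "open_ell2 U \<longleftrightarrow> (\<forall>x\<in>U. eventually (\<lambda>(x', y). x' = x \<longrightarrow> y \<in> U) uniformity)"
instance
proof
  fix x y z :: "'a ell2" and r :: real and U :: "'a ell2 set"
  show "dist x y = norm (x - y)" by (rule dist_ell2_def)
  show "sgn x = x /\<^sub>R norm x" by (rule sgn_ell2_def)
  show "uniformity = (INF e\<in>{0<..}. principal {(x :: 'a ell2, y). dist x y < e})"
    by (rule uniformity_ell2_def)
  show "open U = (\<forall>x\<in>U. eventually (\<lambda>(x', y). x' = x \<longrightarrow> y \<in> U) uniformity)"
    by (rule open_ell2_def)
  show "norm x = sqrt (inner x x)" by (rule norm_ell2_def)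
  show comm: "inner x y = inner y x" for x y :: "'a ell2"
    using ell2_cinner_commute[of x y] by (simp add: inner_ell2_def)
  have "inner z (x + y) = inner z x + inner z y"
    by (simp add: inner_ell2_def ell2_cinner_add_right)
  then show "inner (x + y) z = inner x z + inner y z" by (simp add: comm)
  have "r *\<^sub>R x = of_real r *\<^sub>C x" by (rule ell2_eqI) simp
  then have "inner y (r *\<^sub>R x) = r * inner y x"
    by (simp add: inner_ell2_def ell2_cinner_scaleC_right)
  then show "inner (r *\<^sub>R x) y = r * inner x y" by (simp add: comm)
  show "0 \<le> inner x x" by (simp add: inner_ell2_def ell2_cinner_self infsum_nonneg)
  show "inner x x = 0 \<longleftrightarrow> x = 0"
  proof
    assume "inner x x = 0"
    then have "(\<Sum>\<^sub>\<infinity>a. (cmod (coeff x a))\<^sup>2) = 0" by (simp add: inner_ell2_def ell2_cinner_self)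
    then have "(cmod (coeff x a))\<^sup>2 = 0" for a
      using nonneg_infsum_le_0D[of "\<lambda>a. (cmod (coeff x a))\<^sup>2" UNIV a] coeff_summable[of x] by simp
    then show "x = 0" by (intro ell2_eqI) simp
  qed (simp add: inner_ell2_def ell2_cinner_self)
qed
end

lemma norm_ell2_sq: "(norm x)\<^sup>2 = (\<Sum>\<^sub>\<infinity>a. (cmod (coeff x a))\<^sup>2)"
  by (simp add: norm_ell2_def inner_ell2_def ell2_cinner_self infsum_nonneg)

lemma norm_ell2_sq_diff:
  assumes "\<And>a. (cmod (coeff x a))\<^sup>2 = (cmod (coeff y a))\<^sup>2 - (cmod (coeff z a))\<^sup>2"
  shows "(norm x)\<^sup>2 = (norm y)\<^sup>2 - (norm z)\<^sup>2"
proof -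
  have "(norm x)\<^sup>2 + (norm z)\<^sup>2 = (\<Sum>\<^sub>\<infinity>a. (cmod (coeff x a))\<^sup>2 + (cmod (coeff z a))\<^sup>2)"
    unfolding norm_ell2_sq by (intro infsum_add[symmetric] coeff_summable)
  then show ?thesis by (simp add: norm_ell2_sq assms)
qed

lemma sum_coeff_le: "finite F \<Longrightarrow> (\<Sum>a\<in>F. (cmod (coeff x a))\<^sup>2) \<le> (norm x)\<^sup>2"
  unfolding norm_ell2_sq by (intro finite_sum_le_infsum coeff_summable) auto

lemma coeff_le_norm: "cmod (coeff x a) \<le> norm x"
  using sum_coeff_le[of "{a}" x] by (simp add: power_mono_iff)

instance ell2 :: (type) complete_space
proof
  fix X :: "nat \<Rightarrow> 'a ell2"
  assume X: "Cauchy X"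
  have "Cauchy (\<lambda>n. coeff (X n) a)" for a
  proof (rule metric_CauchyI)
    fix e :: real assume "0 < e"
    from metric_CauchyD[OF X this]
    obtain M where "\<forall>m\<ge>M. \<forall>n\<ge>M. dist (X m) (X n) < e" by blast
    moreover have "dist (coeff (X m) a) (coeff (X n) a) \<le> dist (X m) (X n)" for m n
      using coeff_le_norm[of "X m - X n" a] by (simp add: dist_norm)
    ultimately show "\<exists>M. \<forall>m\<ge>M. \<forall>n\<ge>M. dist (coeff (X m) a) (coeff (X n) a) < e"
      by (meson le_less_trans)
  qed
  then have l: "(\<lambda>n. coeff (X n) a) \<longlonglongrightarrow> lim (\<lambda>n. coeff (X n) a)" for a
    by (simp add: Cauchy_convergent flip: convergent_LIMSEQ_iff)
  define l where "l a = lim (\<lambda>n. coeff (X n) a)" for a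
  note l = l[folded l_def]
  have bound: "\<exists>M. \<forall>n\<ge>M. \<forall>F. finite F \<longrightarrow> (\<Sum>a\<in>F. (cmod (coeff (X n) a - l a))\<^sup>2) \<le> e\<^sup>2"
    if "e > 0" for e
  proof -
    obtain M where M: "\<And>m n. m \<ge> M \<Longrightarrow> n \<ge> M \<Longrightarrow> dist (X m) (X n) < e"
      using metric_CauchyD[OF X \<open>e > 0\<close>] by blast
    have "(\<Sum>a\<in>F. (cmod (coeff (X n) a - l a))\<^sup>2) \<le> e\<^sup>2" if "n \<ge> M" "finite F" for n F
    proof (rule tendsto_upperbound)
      show "(\<lambda>m. \<Sum>a\<in>F. (cmod (coeff (X n) a - coeff (X m) a))\<^sup>2)
        \<longlonglongrightarrow> (\<Sum>a\<in>F. (cmod (coeff (X n) a - l a))\<^sup>2)"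
        by (intro tendsto_intros l)
      have "(\<Sum>a\<in>F. (cmod (coeff (X n) a - coeff (X m) a))\<^sup>2) \<le> e\<^sup>2" if "m \<ge> M" for m
      proof -
        have "(\<Sum>a\<in>F. (cmod (coeff (X n) a - coeff (X m) a))\<^sup>2) \<le> (norm (X n - X m))\<^sup>2"
          using sum_coeff_le[OF \<open>finite F\<close>, of "X n - X m"] by simp
        also have "\<dots> \<le> e\<^sup>2"
          using M[OF \<open>n \<ge> M\<close> \<open>m \<ge> M\<close>] by (intro power_mono) (auto simp: dist_norm)
        finally show ?thesis .
      qed
      then show "\<forall>\<^sub>F m in sequentially. (\<Sum>a\<in>F. (cmod (coeff (X n) a - coeff (X m) a))\<^sup>2) \<le> e\<^sup>2"
        using eventually_sequentially by blast
    qed simp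
    then show ?thesis by blast
  qed
  have diff: "(\<lambda>a. (cmod (coeff (X n) a - l a))\<^sup>2) summable_on UNIV"
    if "\<And>F. finite F \<Longrightarrow> (\<Sum>a\<in>F. (cmod (coeff (X n) a - l a))\<^sup>2) \<le> e\<^sup>2" for n e
    by (rule nonneg_bdd_above_summable_on) (auto intro!: bdd_aboveI2 that)
  obtain M where "\<And>F. finite F \<Longrightarrow> (\<Sum>a\<in>F. (cmod (coeff (X M) a - l a))\<^sup>2) \<le> 1\<^sup>2"
    using bound[of 1] by auto
  then have "(\<lambda>a. (cmod (coeff (X M) a - l a))\<^sup>2) summable_on UNIV" by (rule diff)
  then have "(\<lambda>a. (cmod (l a - coeff (X M) a))\<^sup>2) summable_on UNIV" by (simp add: norm_minus_commute)
  from sq_summable_add[OF this coeff_summable[of "X M"]]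
  have lL: "(\<lambda>a. (cmod (l a))\<^sup>2) summable_on UNIV" by simp
  define L where "L = Abs_ell2 l"
  have L: "coeff L = l" using lL by (simp add: L_def Abs_ell2_inverse)
  have "X \<longlonglongrightarrow> L"
  proof (rule metric_LIMSEQ_I)
    fix e :: real assume "0 < e"
    then obtain M where M: "\<And>n F. n \<ge> M \<Longrightarrow> finite F \<Longrightarrow>
        (\<Sum>a\<in>F. (cmod (coeff (X n) a - l a))\<^sup>2) \<le> (e/2)\<^sup>2"
      using bound[of "e/2"] by auto
    have "dist (X n) L < e" if "n \<ge> M" for n
    proof -
      have "(norm (X n - L))\<^sup>2 \<le> (e/2)\<^sup>2"
        unfolding norm_ell2_sq using M[OF that] coeff_summable[of "X n - L"]
        by (intro infsum_le_finite_sums) (auto simp: L)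
      then have "norm (X n - L) \<le> e/2" using \<open>0 < e\<close> by (simp add: power_mono_iff)
      then show ?thesis using \<open>0 < e\<close> by (simp add: dist_norm)
    qed
    then show "\<exists>M. \<forall>n\<ge>M. dist (X n) L < e" by blast
  qed
  then show "convergent X" by (rule convergentI)
qed

instantiation ell2 :: (type) complex_hilbert
begin
definition cinner_ell2 :: "'a ell2 \<Rightarrow> 'a ell2 \<Rightarrow> complex" where "cinner_ell2 = ell2_cinner"
instance
proof
  fix c d :: complex and x y z :: "'a ell2" and r :: real
  show "c *\<^sub>C (x + y) = c *\<^sub>C x + c *\<^sub>C y" by (rule ell2_eqI) (simp add: distrib_left)
  show "(c + d) *\<^sub>C x = c *\<^sub>C x + d *\<^sub>C x" by (rule ell2_eqI) (simp add: distrib_right)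
  show "c *\<^sub>C d *\<^sub>C x = (c * d) *\<^sub>C x" by (rule ell2_eqI) simp
  show "r *\<^sub>R x = of_real r *\<^sub>C x" by (rule ell2_eqI) simp
  show "cinner x y = cnj (cinner y x)" unfolding cinner_ell2_def by (rule ell2_cinner_commute)
  show "cinner x (y + z) = cinner x y + cinner x z"
    unfolding cinner_ell2_def by (rule ell2_cinner_add_right)
  show "cinner x (c *\<^sub>C y) = c * cinner x y"
    unfolding cinner_ell2_def by (rule ell2_cinner_scaleC_right)
  show "inner x y = Re (cinner x y)" by (simp add: cinner_ell2_def inner_ell2_def)
qed
end


section \<open>The full Fock space\<close>

text \<open>The index set $\{1,\ldots,n\}$ is a finite type \<^typ>\<open>'n\<close>, so that $\mathbb{C}^n$ is
  \<^typ>\<open>complex^'n\<close>. A vector of the full Fock space is given by its coordinates with respect to the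
  orthonormal basis $e_{x_1} \otimes \cdots \otimes e_{x_m}$, indexed by the words
  $x = [x_1, \ldots, x_m]$ of all lengths $m \ge 0$. The empty word belongs to the vacuum.\<close>

type_synonym 'n fock = "'n list ell2"

definition tensor_power :: "nat \<Rightarrow> 'n fock set"
  where "tensor_power m = {u. \<forall>w. length w \<noteq> m \<longrightarrow> coeff u w = 0}"

text \<open>The full Fock space is the Hilbert space direct sum of the tensor powers.\<close>

lemma hilbert_direct_sum_tensor_power: "hilbert_direct_sum tensor_power = (UNIV :: 'n::finite fock set)"
proof -
  have "u \<in> hilbert_direct_sum tensor_power" for u :: "'n fock"
  proof -
    let ?f = "\<lambda>w. (cmod (coeff u w))\<^sup>2"
    have summ: "(\<lambda>w. (cmod (if length w = m then coeff u w else 0))\<^sup>2) summable_on UNIV" for m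
      using coeff_summable[of u] by (rule summable_on_comparison_test) auto
    define h where "h m = Abs_ell2 (\<lambda>w. if length w = m then coeff u w else 0)" for m
    have h: "coeff (h m) w = (if length w = m then coeff u w else 0)" for m w
      using summ by (simp add: h_def Abs_ell2_inverse)
    have coeff_sum: "coeff (\<Sum>m<N. h m) w = (if length w < N then coeff u w else 0)" for N w
      by (induction N) (auto simp: h less_Suc_eq)
    have fin: "finite {w :: 'n list. length w < N}" for N
    proof (rule finite_subset)
      show "finite {w :: 'n list. set w \<subseteq> UNIV \<and> length w \<le> N}" by (rule finite_lists_length_le) simp
    qed auto
    have "filterlim (\<lambda>N. {w :: 'n list. length w < N}) (finite_subsets_at_top UNIV) sequentially"
      unfolding filterlim_finite_subsets_at_top
    proof (intro allI impI)
      fix F :: "'n list set"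
      assume F: "finite F \<and> F \<subseteq> UNIV"
      have "\<forall>\<^sub>F N in sequentially. Max (insert 0 (length ` F)) < N" by (rule eventually_gt_at_top)
      then show "\<forall>\<^sub>F N in sequentially. finite {w :: 'n list. length w < N} \<and>
          F \<subseteq> {w. length w < N} \<and> {w :: 'n list. length w < N} \<subseteq> UNIV"
        by eventually_elim (use F fin in auto)
    qed
    moreover have "(?f has_sum (norm u)\<^sup>2) UNIV"
      unfolding norm_ell2_sq by (intro has_sum_infsum coeff_summable)
    ultimately have lim: "(\<lambda>N. sum ?f {w. length w < N}) \<longlonglongrightarrow> (norm u)\<^sup>2"
      unfolding has_sum_def using filterlim_compose by blast
    have norm_partial: "(norm (\<Sum>m<N. h m))\<^sup>2 = sum ?f {w. length w < N}" for N
    proof -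
      have "(norm (\<Sum>m<N. h m))\<^sup>2 = (\<Sum>\<^sub>\<infinity>w\<in>{w. length w < N}. ?f w)"
        unfolding norm_ell2_sq coeff_sum by (rule infsum_cong_neutral) auto
      then show ?thesis using fin by simp
    qed
    have pyth: "(norm (u - (\<Sum>m<N. h m)))\<^sup>2 = (norm u)\<^sup>2 - (norm (\<Sum>m<N. h m))\<^sup>2" for N
      by (rule norm_ell2_sq_diff) (simp add: coeff_sum)
    have "(\<lambda>N. (norm (u - (\<Sum>m<N. h m)))\<^sup>2) \<longlonglongrightarrow> 0"
      unfolding pyth norm_partial using tendsto_diff[OF tendsto_const lim, of "(norm u)\<^sup>2"] by simp
    then have "(\<lambda>N. sqrt ((norm (u - (\<Sum>m<N. h m)))\<^sup>2)) \<longlonglongrightarrow> sqrt 0" by (rule tendsto_real_sqrt)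
    then have "(\<lambda>N. norm ((\<Sum>m<N. h m) - u)) \<longlonglongrightarrow> 0" by (simp add: norm_minus_commute)
    then have "h sums u" unfolding sums_def by (simp only: LIM_zero_cancel tendsto_norm_zero_iff)
    moreover have "summable (\<lambda>m. (norm (h m))\<^sup>2)"
    proof (rule sums_summable)
      have step: "(norm (h m))\<^sup>2 = (norm (\<Sum>k<Suc m. h k))\<^sup>2 - (norm (\<Sum>k<m. h k))\<^sup>2" for m
        by (rule norm_ell2_sq_diff) (auto simp only: coeff_sum h, auto)
      have "(\<Sum>m<N. (norm (h m))\<^sup>2) = (norm (\<Sum>m<N. h m))\<^sup>2" for N
      proof (induction N)
        case (Suc N)
        then show ?case using step[of N] by simp
      qed simp
      then show "(\<lambda>m. (norm (h m))\<^sup>2) sums (norm u)\<^sup>2" 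
        using lim by (simp only: sums_def norm_partial)
    qed
    moreover have "h m \<in> tensor_power m" for m by (simp add: tensor_power_def h)
    ultimately show ?thesis unfolding hilbert_direct_sum_def by blast
  qed
  then show ?thesis by blast
qed

text \<open>The elementary tensor $v_1 \otimes \cdots \otimes v_m$ of a list of vectors.\<close>

lift_definition tensor :: "(complex^'n::finite) list \<Rightarrow> 'n fock" is
  "\<lambda>vs w. if length w = length vs then \<Prod>k<length vs. (vs ! k) $ (w ! k) else 0"
proof -
  fix vs :: "(complex^'n) list"
  have "finite {w :: 'n list. length w = length vs}"
    using finite_lists_length_eq[of "UNIV :: 'n set"] by simp
  then show "(\<lambda>w. (cmod (if length w = length vs
      then \<Prod>k<length vs. (vs ! k) $ (w ! k) else 0))\<^sup>2) summable_on UNIV"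
    by (rule finite_nonzero_values_imp_summable_on[OF finite_subset, rotated]) auto
qed

text \<open>The product $a \otimes u$ of a vector of $\mathbb{C}^n$ with an element of the Fock space.\<close>

lift_definition tensor_left :: "complex^'n::finite \<Rightarrow> 'n fock \<Rightarrow> 'n fock" is
  "\<lambda>a f w. case w of [] \<Rightarrow> 0 | j # v \<Rightarrow> a $ j * f v"
proof -
  fix a :: "complex^'n" and f :: "'n list \<Rightarrow> complex"
  assume f: "(\<lambda>w. (cmod (f w))\<^sup>2) summable_on UNIV"
  let ?g = "\<lambda>w. (cmod (case w of [] \<Rightarrow> 0 | j # v \<Rightarrow> a $ j * f v))\<^sup>2"
  have cons: "?g summable_on range (Cons j)" for j
    using sq_summable_cmult[OF f, of "a $ j"] by (subst summable_on_reindex) (auto simp: o_def)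
  have "?g summable_on (\<Union>j. range (Cons j))"
    by (rule summable_on_finite_union_disjoint) (auto intro: cons)
  then have "?g summable_on insert [] (\<Union>j. range (Cons j))"
    by (simp only: summable_on_insert_iff)
  moreover have "w \<in> insert [] (\<Union>j. range (Cons j))" for w :: "'n list"
    by (cases w) auto
  then have "insert [] (\<Union>j. range (Cons j)) = (UNIV :: 'n list set)" by blast
  ultimately show "?g summable_on UNIV" by simp
qed

lemma tensor_left_tensor: "tensor_left a (tensor vs) = tensor (a # vs)"
proof (rule ell2_eqI)
  show "coeff (tensor_left a (tensor vs)) w = coeff (tensor (a # vs)) w" for w
    by (cases w) (simp_all add: tensor_left.rep_eq tensor.rep_eq prod.lessThan_Suc_shift
        del: prod.lessThan_Suc)
qed

definition basis_tensor :: "'n::finite list \<Rightarrow> 'n fock"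
  where "basis_tensor x = tensor (map (\<lambda>i. axis i 1) x)"

lemma coeff_basis_tensor:
  fixes x :: "'n::finite list"
  shows "coeff (basis_tensor x) w = (if w = x then 1 else 0)"
proof (cases "length w = length x")
  case True
  have "(\<Prod>k<length x. (axis (x ! k) 1 :: complex^'n) $ (w ! k)) = (if w = x then 1 else 0)"
  proof (cases "w = x")
    case False
    with True obtain k where "k < length x" "w ! k \<noteq> x ! k" using nth_equalityI by metis
    then show ?thesis using False by (auto simp: axis_def intro!: prod_zero)
  qed (simp add: axis_def)
  then show ?thesis using True by (simp add: basis_tensor_def tensor.rep_eq)
qed (auto simp: basis_tensor_def tensor.rep_eq)

definition creation :: "'n::finite \<Rightarrow> 'n fock \<Rightarrow> 'n fock"
  where "creation i u = tensor_left (axis i 1) u"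

lemma coeff_creation:
  "coeff (creation i u) w = (case w of [] \<Rightarrow> 0 | j # v \<Rightarrow> if j = i then coeff u v else 0)"
  by (auto simp: creation_def tensor_left.rep_eq axis_def split: list.split)

lemma cadjoint_creation: "cinner (creation i x) y = cinner x (cadjoint (creation i) y)"
  and coeff_cadjoint_creation: "coeff (cadjoint (creation i) u) w = coeff u (i # w)"
proof -
  have summ: "(\<lambda>w. (cmod (coeff u (i # w)))\<^sup>2) summable_on UNIV" for u :: "'a fock"
    using summable_on_subset[OF coeff_summable[of u] subset_UNIV, of "range (Cons i)"]
    by (simp add: summable_on_reindex o_def)
  define A where "A u = Abs_ell2 (\<lambda>w. coeff u (i # w))" for u :: "'a fock"
  have A: "coeff (A u) w = coeff u (i # w)" for u w
    using summ[of u] by (simp add: A_def Abs_ell2_inverse)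
  have cinner_A: "cinner (creation i x) y = cinner x (A y)" for x y
  proof -
    have "(\<Sum>\<^sub>\<infinity>w. cnj (coeff (creation i x) w) * coeff y w) =
        (\<Sum>\<^sub>\<infinity>w\<in>range (Cons i). cnj (coeff (creation i x) w) * coeff y w)"
      by (rule infsum_cong_neutral) (auto simp: coeff_creation split: list.splits)
    also have "\<dots> = (\<Sum>\<^sub>\<infinity>w. cnj (coeff x w) * coeff y (i # w))"
      by (subst infsum_reindex) (auto simp: o_def coeff_creation)
    finally show ?thesis by (simp add: cinner_ell2_def ell2_cinner_def A)
  qed
  then have "cadjoint (creation i) = A" by (rule cadjoint_eqI)
  then show "cinner (creation i x) y = cinner x (cadjoint (creation i) y)"
    and "coeff (cadjoint (creation i) u) w = coeff u (i # w)" by (simp_all add: A cinner_A)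
qed

lemma creation_scaleC: "creation i (c *\<^sub>C u) = c *\<^sub>C creation i u"
  by (rule ell2_eqI) (auto simp: coeff_creation split: list.split)

lemma norm_creation: "norm (creation i u) = norm u"
proof -
  have "cadjoint (creation i) (creation i u) = u"
    by (rule ell2_eqI) (simp add: coeff_cadjoint_creation coeff_creation)
  then have "inner (creation i u) (creation i u) = inner u u"
    by (simp only: inner_eq_Re_cinner cadjoint_creation)
  then show ?thesis by (simp only: norm_eq_sqrt_inner)
qed

lemma bounded_linear_creation: "bounded_linear (creation i)"
proof (rule bounded_linear_intro[of _ 1])
  show "creation i (x + y) = creation i x + creation i y" for x y
    by (rule ell2_eqI) (auto simp: coeff_creation split: list.split)
qed (simp_all add: norm_creation creation_scaleC scaleR_scaleC)

definition q_fock :: "('n::finite \<Rightarrow> 'n \<Rightarrow> complex) \<Rightarrow> 'n fock set"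
  where "q_fock q = max_q_commuting q creation"


section \<open>The twisted permutation operators\<close>

text \<open>Positions in a word are numbered from 0. A permutation \<^term>\<open>\<sigma>\<close> sends the word with letters
  $x_k$ to the word \<^term>\<open>permute_list (inv \<sigma>) x\<close> with letters $x_{\sigma^{-1}(k)}$.\<close>

definition q_factor :: "('n \<Rightarrow> 'n \<Rightarrow> complex) \<Rightarrow> (nat \<Rightarrow> nat) \<Rightarrow> 'n list \<Rightarrow> complex"
  where "q_factor q \<sigma> x =
    (\<Prod>(i, k)\<in>{(i, k). i < k \<and> k < length x \<and> inv \<sigma> i > inv \<sigma> k}. q (x ! inv \<sigma> i) (x ! inv \<sigma> k))"

text \<open>The linear extension of $e_x \mapsto q^\sigma(x)\, e_{x \circ \sigma^{-1}}$ from words $x$ of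
  length \<^term>\<open>m\<close>. It is applied to elements of \<^term>\<open>tensor_power m\<close> only.\<close>

definition U_op ::
    "nat \<Rightarrow> ('n::finite \<Rightarrow> 'n \<Rightarrow> complex) \<Rightarrow> (nat \<Rightarrow> nat) \<Rightarrow> 'n fock \<Rightarrow> 'n fock"
  where "U_op m q \<sigma> u =
    (\<Sum>x | length x = m. coeff u x *\<^sub>C q_factor q \<sigma> x *\<^sub>C basis_tensor (permute_list (inv \<sigma>) x))"

lemma U_op_basis_tensor:
  assumes "length x = m"
  shows "U_op m q \<sigma> (basis_tensor x) = q_factor q \<sigma> x *\<^sub>C basis_tensor (permute_list (inv \<sigma>) x)"
proof -
  have "finite {y :: 'a list. length y = m}"
    using finite_lists_length_eq[of "UNIV :: 'a set" m] by simp
  then show ?thesis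
    using assms unfolding U_op_def
    by (subst sum.remove[of _ x]) (auto simp: coeff_basis_tensor intro!: sum.neutral)
qed

definition q_tensor_power :: "('n::finite \<Rightarrow> 'n \<Rightarrow> complex) \<Rightarrow> nat \<Rightarrow> 'n fock set"
  where "q_tensor_power q m =
    (if m = 0 then tensor_power 0
     else {u \<in> tensor_power m. \<forall>\<sigma>. \<sigma> permutes {..<m} \<longrightarrow> U_op m q \<sigma> u = u})"

end

theory Submission
  imports Defs
begin

text \<open>
  Let $u(x)$ denote the coordinate of $u$ at the word $x$. Both sides of the theorem turn out to be
  the set \<^term>\<open>q_symmetric q\<close> of those $u$ for which interchanging two neighbouring letters of a
  word multiplies the coordinate by the corresponding $q_{ij}$.

  The adjoint of the creation operator $V_i$ maps $u$ to the vector with coordinates $u(ix)$. The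
  relation $V_i^* V_j^* u = \overline{q_{ij}}\, V_j^* V_i^* u$ therefore governs the interchange of
  the first two letters, and invariance under all $V_a^*$ carries it to every position in a word.
  This identifies \<^term>\<open>q_symmetric q\<close> with the largest q-commuting subspace (\<open>q_fock_eq\<close>).

  On the other side one has to pass from neighbouring interchanges to arbitrary permutations,
  keeping track of the scalar $q^\sigma(x)$. Rather than factoring $\sigma$, one observes that this
  scalar is a coboundary. Choose nonzero numbers $r_{ij}$ with $r_{ij} = q_{ij} r_{ji}$ and let
  $W(x) = \prod_{i<k} r_{x_i x_k}$. Permuting the letters of $x$ permutes the unordered pairs of
  positions, and precisely the inverted pairs change the order of their two letters. So
  $W(x \circ \sigma^{-1}) = q^\sigma(x)\, W(x)$ (\<open>weight_permute_list\<close>). After division by $W$, being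
  fixed by all the operators $U_\sigma$ means that $u(x)/W(x)$ depends only on the multiset of
  letters of $x$, and membership in \<^term>\<open>q_symmetric q\<close> means that $u(x)/W(x)$ does not change
  under neighbouring interchanges. These two conditions agree, since neighbouring interchanges
  connect any two words with the same multiset of letters. Hence the fixed vectors in the $m$-th
  tensor power are the homogeneous elements of \<^term>\<open>q_symmetric q\<close> of degree $m$
  (\<open>q_tensor_power_eq\<close>).

  Finally, the condition defining \<^term>\<open>q_symmetric q\<close> relates words of equal length only, so an
  element of the Fock space satisfies it if and only if all its homogeneous components do
  (\<open>hilbert_direct_sum_q_symmetric\<close>).
\<close>

section \<open>Coordinate functionals\<close>

lemma bounded_linear_coeff: "bounded_linear (\<lambda>u. coeff u w)"
  by (rule bounded_linear_intro[of _ 1]) (auto simp: coeff_le_norm scaleR_conv_of_real)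

lemma coeff_sum: "coeff (\<Sum>y\<in>B. g y) z = (\<Sum>y\<in>B. coeff (g y) z)"
  by (rule linear_sum[OF bounded_linear.linear[OF bounded_linear_coeff]])

section \<open>Weights of words\<close>

text \<open>With respect to a linear order of the letters, $r_{ij}$ may be taken to be $q_{ij}$ if $i > j$
  and $1$ otherwise. A square root of $q_{ij}$ would not do: if $q_{ij} = q_{ji} = -1$ then
  principal square roots give $r_{ij} = r_{ji}$.\<close>
lemma exists_skew_factorisation:
  fixes q :: "'n::finite \<Rightarrow> 'n \<Rightarrow> 'a::field"
  assumes nz: "\<And>i j. q i j \<noteq> 0" and diag: "\<And>i. q i i = 1"
    and inv: "\<And>i j. q j i = inverse (q i j)"
  obtains r where "\<And>i j. r i j \<noteq> 0" "\<And>i j. r i j = q i j * r j i"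
proof -
  obtain f :: "'n \<Rightarrow> nat" where f: "inj f"
    using finite_imp_inj_to_nat_seg[of "UNIV :: 'n set"] by auto
  let ?r = "\<lambda>i j. if f i > f j then q i j else 1"
  have "?r i j = q i j * ?r j i" for i j
  proof (cases "i = j")
    case False
    then have "f i \<noteq> f j" using f by (auto dest: injD)
    then show ?thesis using nz inv[of i j] by (auto simp: not_less)
  qed (simp add: diag)
  show thesis
  proof (rule that[of ?r])
    show "?r i j \<noteq> 0" for i j using nz by simp
  qed fact
qed

text \<open>The product $\prod_{i<k} r_{x_i x_k}$ over all pairs of positions of a word. The recursion makes
  the effect of interchanging neighbouring letters immediate, whatever precedes them.\<close>
primrec weight :: "('n \<Rightarrow> 'n \<Rightarrow> 'a::comm_monoid_mult) \<Rightarrow> 'n list \<Rightarrow> 'a" where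
  "weight r [] = 1"
| "weight r (a # w) = prod_list (map (r a) w) * weight r w"

lemma weight_nonzero:
  fixes r :: "'n \<Rightarrow> 'n \<Rightarrow> 'a::field"
  shows "(\<And>i j. r i j \<noteq> 0) \<Longrightarrow> weight r w \<noteq> 0"
  by (induction w) (auto simp: prod_list_zero_iff)

lemma weight_swap:
  assumes "r j i = c * r i j"
  shows "weight r (p @ j # i # w) = c * weight r (p @ i # j # w)"
  by (induction p) (simp_all add: assms ac_simps)

definition pairs_below :: "nat \<Rightarrow> (nat \<times> nat) set"
  where "pairs_below m = {(i, k). i < k \<and> k < m}"

lemma finite_pairs_below [simp]: "finite (pairs_below m)"
  by (rule finite_subset[of _ "{..<m} \<times> {..<m}"]) (auto simp: pairs_below_def)

lemma weight_eq_prod_pairs: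
  "weight r w = (\<Prod>(i, k)\<in>pairs_below (length w). r (w ! i) (w ! k))"
proof -
  have "weight r w = (\<Prod>k<length w. \<Prod>i<k. r (w ! i) (w ! k))"
  proof (induction w)
    case (Cons a w)
    have "prod_list (map (r a) w) = (\<Prod>k<length w. r a (w ! k))"
      by (simp add: prod.list_conv_set_nth atLeast0LessThan)
    with Cons show ?case
      by (simp add: prod.lessThan_Suc_shift prod.distrib del: prod.lessThan_Suc)
  qed simp
  also have "\<dots> = (\<Prod>(k, i)\<in>(SIGMA k:{..<length w}. {..<k}). r (w ! i) (w ! k))"
    by (rule prod.Sigma) auto
  also have "\<dots> = (\<Prod>(i, k)\<in>pairs_below (length w). r (w ! i) (w ! k))"
    by (rule prod.reindex_bij_witness[of _ prod.swap prod.swap]) (auto simp: pairs_below_def)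
  finally show ?thesis .
qed

text \<open>Increasing pairs stand for unordered pairs of positions. A permutation acts on these, once its
  values are sorted again.\<close>
definition sort_pair :: "nat \<times> nat \<Rightarrow> nat \<times> nat"
  where "sort_pair = (\<lambda>(i, k). (min i k, max i k))"

lemma bij_betw_sort_pair_permutes:
  assumes "\<pi> permutes {..<m}"
  shows "bij_betw (\<lambda>(i, k). sort_pair (\<pi> i, \<pi> k)) (pairs_below m) (pairs_below m)"
proof -
  have le: "\<pi> i < m \<longleftrightarrow> i < m" "inv \<pi> i < m \<longleftrightarrow> i < m" for i
    using permutes_in_image[OF assms] permutes_in_image[OF permutes_inv[OF assms]] by auto
  have inj: "\<pi> i = \<pi> k \<longleftrightarrow> i = k" "inv \<pi> i = inv \<pi> k \<longleftrightarrow> i = k" for i k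
    using permutes_inj[OF assms] permutes_inj[OF permutes_inv[OF assms]] by (auto dest: injD)
  have less: "\<pi> i \<le> \<pi> k \<longleftrightarrow> \<pi> i < \<pi> k" "inv \<pi> i \<le> inv \<pi> k \<longleftrightarrow> inv \<pi> i < inv \<pi> k"
    if "i \<noteq> k" for i k
    using that inj[of i k] by (auto simp: order.order_iff_strict)
  show ?thesis
    by (rule bij_betw_byWitness[where f' = "\<lambda>(i, k). sort_pair (inv \<pi> i, inv \<pi> k)"])
      (auto simp: pairs_below_def sort_pair_def min_def max_def le inj less not_less
        permutes_inverses[OF assms] split: if_splits)
qed

text \<open>The letters at the positions $i < k$ of the permuted word come from the positions
  $\sigma^{-1}(i)$ and $\sigma^{-1}(k)$. If these are inverted, the weight of $x$ contains
  $r$ with its two arguments exchanged, and the quotient of the two factors is the factor of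
  $q^\sigma(x)$ that belongs to this pair. Otherwise the two factors are equal.\<close>
lemma weight_permute_list:
  fixes q r :: "'n \<Rightarrow> 'n \<Rightarrow> complex"
  assumes r: "\<And>i j. r i j = q i j * r j i" and \<sigma>: "\<sigma> permutes {..<length x}"
  shows "weight r (permute_list (inv \<sigma>) x) = q_factor q \<sigma> x * weight r x"
proof -
  define m where "m = length x"
  define \<pi> where "\<pi> = inv \<sigma>"
  have \<pi>: "\<pi> permutes {..<m}" unfolding \<pi>_def m_def by (rule permutes_inv[OF \<sigma>])
  have nth: "permute_list \<pi> x ! i = x ! \<pi> i" if "i < m" for i
    using that \<pi> by (simp add: permute_list_nth m_def)
  \<comment> \<open>All three products are written over the same set of pairs of positions of the permuted word.\<close>
  have "q_factor q \<sigma> x = (\<Prod>(i, k)\<in>pairs_below m. if \<pi> i > \<pi> k then q (x ! \<pi> i) (x ! \<pi> k) else 1)"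
    unfolding q_factor_def
    by (rule prod.mono_neutral_cong_left)
      (auto simp: \<pi>_def m_def pairs_below_def intro: finite_subset[OF _ finite_pairs_below[of m]]
        split: if_splits)
  moreover have "weight r x =
      (\<Prod>(i, k)\<in>pairs_below m. case sort_pair (\<pi> i, \<pi> k) of (i', k') \<Rightarrow> r (x ! i') (x ! k'))"
    unfolding weight_eq_prod_pairs m_def[symmetric]
    by (subst prod.reindex_bij_betw[OF bij_betw_sort_pair_permutes[OF \<pi>], symmetric])
      (simp add: case_prod_unfold)
  moreover have "weight r (permute_list \<pi> x) =
      (\<Prod>(i, k)\<in>pairs_below m. (if \<pi> i > \<pi> k then q (x ! \<pi> i) (x ! \<pi> k) else 1) *
        (case sort_pair (\<pi> i, \<pi> k) of (i', k') \<Rightarrow> r (x ! i') (x ! k')))"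
  proof -
    have factor: "r (x ! a) (x ! b) = (if a > b then q (x ! a) (x ! b) else 1) *
        (case sort_pair (a, b) of (i', k') \<Rightarrow> r (x ! i') (x ! k'))" for a b
      using r[of "x ! a" "x ! b"] by (simp add: sort_pair_def min_def max_def)
    have "r (permute_list \<pi> x ! i) (permute_list \<pi> x ! k) =
        (if \<pi> i > \<pi> k then q (x ! \<pi> i) (x ! \<pi> k) else 1) *
        (case sort_pair (\<pi> i, \<pi> k) of (i', k') \<Rightarrow> r (x ! i') (x ! k'))"
      if "(i, k) \<in> pairs_below m" for i k
    proof -
      have "i < m" "k < m" using that by (auto simp: pairs_below_def)
      then show ?thesis using factor[of "\<pi> i" "\<pi> k"] by (simp only: nth)
    qed
    then show ?thesis
      unfolding weight_eq_prod_pairs length_permute_list m_def[symmetric]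
      by (intro prod.cong refl) (simp only: split_paired_all prod.case)
  qed
  ultimately show ?thesis
    unfolding \<pi>_def[symmetric] by (simp only: case_prod_unfold prod.distrib)
qed

section \<open>Twisted symmetric vectors\<close>

definition q_symmetric :: "('n \<Rightarrow> 'n \<Rightarrow> complex) \<Rightarrow> 'n fock set"
  where "q_symmetric q =
    {u. \<forall>p i j w. coeff u (p @ j # i # w) = q j i * coeff u (p @ i # j # w)}"

lemma q_symmetricD:
  "u \<in> q_symmetric q \<Longrightarrow> coeff u (p @ j # i # w) = q j i * coeff u (p @ i # j # w)"
  unfolding q_symmetric_def by blast

lemma q_symmetricI:
  "(\<And>p i j w. coeff u (p @ j # i # w) = q j i * coeff u (p @ i # j # w)) \<Longrightarrow> u \<in> q_symmetric q"
  unfolding q_symmetric_def by blast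

text \<open>Neighbouring interchanges can move any letter of a word to the front, so that two words with the
  same letters can be made to agree letter by letter.\<close>
lemma adjacent_swap_invariant_mset_eq:
  assumes swap: "\<And>p a b w. f (p @ a # b # w) = f (p @ b # a # w)" and "mset x = mset y"
  shows "f x = f y"
proof -
  have move: "f (p @ ys @ a # zs) = f (p @ a # ys @ zs)" for p ys a zs
  proof (induction ys arbitrary: p)
    case (Cons b ys)
    from Cons.IH[of "p @ [b]"] swap[of p b a "ys @ zs"] show ?case by simp
  qed simp
  have "f (p @ x) = f (p @ y)" for p
    using \<open>mset x = mset y\<close>
  proof (induction x arbitrary: y p)
    case (Cons a x)
    then have "a \<in> set y" by (metis list.set_intros(1) mset_eq_setD)
    then obtain ys zs where y: "y = ys @ a # zs" by (meson split_list)
    with Cons.prems have "mset x = mset (ys @ zs)" by simp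
    from Cons.IH[OF this, of "p @ [a]"] show ?case by (simp add: y move)
  qed simp
  from this[of "[]"] show ?thesis by simp
qed

text \<open>The weight itself transforms like the coordinates of an element of \<^term>\<open>q_symmetric q\<close>, which
  turns twisted symmetry of the coordinates into plain symmetry of their quotients by the
  weight.\<close>
lemma q_symmetric_iff_weight:
  fixes q r :: "'n \<Rightarrow> 'n \<Rightarrow> complex"
  assumes nz: "\<And>i j. r i j \<noteq> 0" and r: "\<And>i j. r i j = q i j * r j i"
  shows "u \<in> q_symmetric q \<longleftrightarrow>
    (\<forall>x y. mset x = mset y \<longrightarrow> coeff u x / weight r x = coeff u y / weight r y)"
proof -
  have swap: "weight r (p @ j # i # w) = q j i * weight r (p @ i # j # w)" for p i j w
    by (rule weight_swap) (rule r)
  have q: "q i j \<noteq> 0" for i j using nz[of i j] r[of i j] by auto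
  note W = weight_nonzero[of r, OF nz]
  show ?thesis
  proof (intro iffI allI impI)
    fix x y :: "'n list"
    assume u: "u \<in> q_symmetric q" and "mset x = mset y"
    have "coeff u (p @ a # b # w) / weight r (p @ a # b # w) =
        coeff u (p @ b # a # w) / weight r (p @ b # a # w)" for p a b w
    proof -
      have "coeff u (p @ a # b # w) = q a b * coeff u (p @ b # a # w)"
        using u by (rule q_symmetricD)
      then show ?thesis using q by (simp add: swap[of p a b])
    qed
    from adjacent_swap_invariant_mset_eq[of "\<lambda>x. coeff u x / weight r x", OF this \<open>mset x = mset y\<close>]
    show "coeff u x / weight r x = coeff u y / weight r y" .
  next
    assume sym: "\<forall>x y. mset x = mset y \<longrightarrow> coeff u x / weight r x = coeff u y / weight r y"
    show "u \<in> q_symmetric q"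
    proof (rule q_symmetricI)
      fix p i j w
      have "coeff u (p @ j # i # w) / weight r (p @ j # i # w) =
          coeff u (p @ i # j # w) / weight r (p @ i # j # w)"
        by (rule sym[rule_format]) simp
      then show "coeff u (p @ j # i # w) = q j i * coeff u (p @ i # j # w)"
        using q W by (simp add: swap[of p j i] field_simps)
    qed
  qed
qed

section \<open>Fixed vectors of the twisted permutation operators\<close>

lemma coeff_U_op:
  fixes u :: "'n::finite fock"
  assumes \<sigma>: "\<sigma> permutes {..<length x}"
  shows "coeff (U_op (length x) q \<sigma> u) (permute_list (inv \<sigma>) x) = q_factor q \<sigma> x * coeff u x"
proof -
  let ?A = "{y :: 'n list. length y = length x}"
  have fin: "finite ?A"
    using finite_lists_length_eq[of "UNIV :: 'n set" "length x"] by simp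
  have inj: "permute_list (inv \<sigma>) x = permute_list (inv \<sigma>) y \<longleftrightarrow> x = y" if "y \<in> ?A" for y
  proof -
    have "permute_list \<sigma> (permute_list (inv \<sigma>) z) = z" if "length z = length x" for z :: "'n list"
      using that \<sigma> permute_list_compose[of \<sigma> z "inv \<sigma>"]
      by (simp add: permutes_inv_o[OF \<sigma>])
    then show ?thesis using that by (metis mem_Collect_eq)
  qed
  have "coeff (U_op (length x) q \<sigma> u) (permute_list (inv \<sigma>) x) =
      (\<Sum>y\<in>?A. if x = y then coeff u y * q_factor q \<sigma> y else 0)"
    unfolding U_op_def coeff_sum
    by (rule sum.cong) (simp_all add: coeff_basis_tensor inj)
  also have "\<dots> = coeff u x * q_factor q \<sigma> x" using fin by simp
  finally show ?thesis by (simp only: mult.commute)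
qed

lemma U_op_in_tensor_power: "U_op m q \<sigma> u \<in> tensor_power m"
  by (auto simp: tensor_power_def U_op_def coeff_sum coeff_basis_tensor intro!: sum.neutral)

lemma U_op_fixed_iff:
  fixes u :: "'n::finite fock"
  assumes u: "u \<in> tensor_power m" and \<sigma>: "\<sigma> permutes {..<m}"
  shows "U_op m q \<sigma> u = u \<longleftrightarrow>
    (\<forall>x. length x = m \<longrightarrow> coeff u (permute_list (inv \<sigma>) x) = q_factor q \<sigma> x * coeff u x)"
    (is "_ \<longleftrightarrow> ?R")
proof
  assume "U_op m q \<sigma> u = u"
  then show ?R using coeff_U_op[of \<sigma> _ q u] \<sigma> by metis
next
  assume R: ?R
  show "U_op m q \<sigma> u = u"
  proof (rule ell2_eqI)
    fix y :: "'n list"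
    show "coeff (U_op m q \<sigma> u) y = coeff u y"
    proof (cases "length y = m")
      case True
      define x where "x = permute_list \<sigma> y"
      have x: "length x = m" "permute_list (inv \<sigma>) x = y"
        using True \<sigma> permute_list_compose[of "inv \<sigma>" y \<sigma>] permutes_inv[OF \<sigma>]
        by (simp_all add: x_def permutes_inv_o[OF \<sigma>])
      then show ?thesis using R coeff_U_op[of \<sigma> x q u] \<sigma> by auto
    qed (use u U_op_in_tensor_power[of m q \<sigma> u] in \<open>simp add: tensor_power_def\<close>)
  qed
qed

lemma q_tensor_power_eq:
  fixes q :: "'n::finite \<Rightarrow> 'n \<Rightarrow> complex"
  assumes "\<And>i j. q i j \<noteq> 0" "\<And>i. q i i = 1" "\<And>i j. q j i = inverse (q i j)"
  shows "q_tensor_power q m = tensor_power m \<inter> q_symmetric q"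
proof -
  obtain r where nz: "\<And>i j. r i j \<noteq> 0" and r: "\<And>i j. r i j = q i j * r j i"
    using exists_skew_factorisation[of q] assms by blast
  note W = weight_nonzero[of r, OF nz]
  have "(\<forall>\<sigma>. \<sigma> permutes {..<m} \<longrightarrow> U_op m q \<sigma> u = u) \<longleftrightarrow> u \<in> q_symmetric q"
    if u: "u \<in> tensor_power m" for u :: "'n fock"
  proof -
    have "(\<forall>\<sigma>. \<sigma> permutes {..<m} \<longrightarrow> U_op m q \<sigma> u = u) \<longleftrightarrow>
      (\<forall>\<sigma> x. \<sigma> permutes {..<m} \<longrightarrow> length x = m \<longrightarrow>
        coeff u (permute_list (inv \<sigma>) x) = q_factor q \<sigma> x * coeff u x)"
      using U_op_fixed_iff[OF u] by blast
    also have "\<dots> \<longleftrightarrow> (\<forall>\<sigma> x. \<sigma> permutes {..<m} \<longrightarrow> length x = m \<longrightarrow>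
        coeff u (permute_list (inv \<sigma>) x) / weight r (permute_list (inv \<sigma>) x) =
        coeff u x / weight r x)"
    proof -
      have "coeff u (permute_list (inv \<sigma>) x) = q_factor q \<sigma> x * coeff u x \<longleftrightarrow>
          coeff u (permute_list (inv \<sigma>) x) / weight r (permute_list (inv \<sigma>) x) =
          coeff u x / weight r x"
        if "\<sigma> permutes {..<m}" "length x = m" for \<sigma> x
      proof -
        have "weight r (permute_list (inv \<sigma>) x) = q_factor q \<sigma> x * weight r x"
          by (rule weight_permute_list[of r q, OF r]) (use that in simp)
        with W[of "permute_list (inv \<sigma>) x"] W[of x] show ?thesis
          by (auto simp: field_simps)
      qed
      then show ?thesis by (simp cong: imp_cong)
    qed
    also have "\<dots> \<longleftrightarrow> (\<forall>x y. mset x = mset y \<longrightarrow> coeff u x / weight r x = coeff u y / weight r y)"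
    proof (intro iffI allI impI)
      fix x y :: "'n list"
      assume inv: "\<forall>\<sigma> x. \<sigma> permutes {..<m} \<longrightarrow> length x = m \<longrightarrow>
        coeff u (permute_list (inv \<sigma>) x) / weight r (permute_list (inv \<sigma>) x) =
        coeff u x / weight r x"
      assume eq: "mset x = mset y"
      then have len: "length x = length y" by (rule mset_eq_length)
      show "coeff u x / weight r x = coeff u y / weight r y"
      proof (cases "length y = m")
        case True
        obtain \<pi> where \<pi>: "\<pi> permutes {..<length y}" "permute_list \<pi> y = x"
          using mset_eq_permutation[OF eq] by blast
        have "inv (inv \<pi>) = \<pi>" by (rule permutes_inv_inv[OF \<pi>(1)])
        then show ?thesis
          using inv[rule_format, of "inv \<pi>" y] True \<pi> permutes_inv[OF \<pi>(1)] by simp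
      qed (use u len in \<open>simp add: tensor_power_def\<close>)
    next
      fix \<sigma> and x :: "'n list"
      assume "\<forall>x y. mset x = mset y \<longrightarrow> coeff u x / weight r x = coeff u y / weight r y"
        and "\<sigma> permutes {..<m}" "length x = m"
      then show "coeff u (permute_list (inv \<sigma>) x) / weight r (permute_list (inv \<sigma>) x) =
          coeff u x / weight r x"
        using mset_permute_list[of "inv \<sigma>" x] permutes_inv[of \<sigma>] by blast
    qed
    also have "\<dots> \<longleftrightarrow> u \<in> q_symmetric q"
      by (rule q_symmetric_iff_weight[OF nz r, symmetric])
    finally show ?thesis .
  qed
  \<comment> \<open>In degree 0 no invariance is imposed, but there is nothing to interchange in the empty word.\<close>
  moreover have "tensor_power 0 \<subseteq> q_symmetric q"
    by (auto simp: tensor_power_def intro: q_symmetricI)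
  ultimately show ?thesis by (auto simp: q_tensor_power_def)
qed

section \<open>The Hilbert space direct sum\<close>

text \<open>Only one member of a family of homogeneous vectors of distinct degrees contributes to a given
  coordinate.\<close>
lemma coeff_sums_homogeneous:
  assumes "\<And>m. h m \<in> tensor_power m" "h sums u"
  shows "coeff u w = coeff (h (length w)) w"
proof -
  have "(\<lambda>m. coeff (h m) w) sums coeff u w"
    by (rule bounded_linear.sums[OF bounded_linear_coeff assms(2)])
  moreover have "(\<lambda>m. coeff (h m) w) sums (\<Sum>m\<in>{length w}. coeff (h m) w)"
    using assms(1) by (intro sums_finite) (auto simp: tensor_power_def)
  ultimately show ?thesis using sums_unique2 by fastforce
qed

lemma hilbert_direct_sum_q_symmetric:
  "hilbert_direct_sum (\<lambda>m. tensor_power m \<inter> q_symmetric q) = (q_symmetric q :: 'n::finite fock set)"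
proof (intro set_eqI iffI)
  fix u :: "'n fock"
  assume "u \<in> hilbert_direct_sum (\<lambda>m. tensor_power m \<inter> q_symmetric q)"
  then obtain h where h: "\<And>m. h m \<in> tensor_power m" "\<And>m. h m \<in> q_symmetric q" "h sums u"
    by (auto simp: hilbert_direct_sum_def)
  show "u \<in> q_symmetric q"
  proof (rule q_symmetricI)
    show "coeff u (p @ j # i # w) = q j i * coeff u (p @ i # j # w)" for p i j w
      using q_symmetricD[OF h(2), of _ p j i w] by (simp add: coeff_sums_homogeneous[OF h(1,3)])
  qed
next
  fix u :: "'n fock"
  assume u: "u \<in> q_symmetric q"
  have "u \<in> hilbert_direct_sum tensor_power" by (simp add: hilbert_direct_sum_tensor_power)
  then obtain h where h: "\<And>m. h m \<in> tensor_power m" "summable (\<lambda>m. (norm (h m))\<^sup>2)" "h sums u"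
    by (auto simp: hilbert_direct_sum_def)
  have coeff_h: "coeff (h m) w = (if length w = m then coeff u w else 0)" for m w
    using h(1)[of m] coeff_sums_homogeneous[OF h(1,3), of w] by (auto simp: tensor_power_def)
  have "h m \<in> q_symmetric q" for m
  proof (rule q_symmetricI)
    show "coeff (h m) (p @ j # i # w) = q j i * coeff (h m) (p @ i # j # w)" for p i j w
      using q_symmetricD[OF u, of p j i w] by (simp add: coeff_h)
  qed
  then show "u \<in> hilbert_direct_sum (\<lambda>m. tensor_power m \<inter> q_symmetric q)"
    using h by (auto simp: hilbert_direct_sum_def)
qed

section \<open>The maximal q-commuting subspace\<close>

lemma is_q_commuting_on_q_symmetric:
  fixes q :: "'n::finite \<Rightarrow> 'n \<Rightarrow> complex"
  assumes "\<And>i j. cnj (q i j) = q j i"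
  shows "is_q_commuting_on q creation (q_symmetric q)"
  unfolding is_q_commuting_on_def
proof (intro conjI allI ballI)
  show "complex_vector.subspace (q_symmetric q)"
  proof (rule complex_vector.subspaceI; rule q_symmetricI)
    fix u v :: "'n fock" and c :: complex and p i j w
    assume u: "u \<in> q_symmetric q"
    show "coeff (c *\<^sub>C u) (p @ j # i # w) = q j i * coeff (c *\<^sub>C u) (p @ i # j # w)"
      using q_symmetricD[OF u, of p j i w] by simp
    assume v: "v \<in> q_symmetric q"
    show "coeff (u + v) (p @ j # i # w) = q j i * coeff (u + v) (p @ i # j # w)"
      using q_symmetricD[OF u, of p j i w] q_symmetricD[OF v, of p j i w]
      by (simp add: distrib_left)
  qed simp
  show "closed (q_symmetric q)"
    unfolding q_symmetric_def
    by (intro closed_Collect_all closed_Collect_eq continuous_on_mult_left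
        linear_continuous_on[OF bounded_linear_coeff])
next
  fix i and u :: "'n fock"
  assume u: "u \<in> q_symmetric q"
  show "cadjoint (creation i) u \<in> q_symmetric q"
  proof (rule q_symmetricI)
    show "coeff (cadjoint (creation i) u) (p @ k # l # w) =
        q k l * coeff (cadjoint (creation i) u) (p @ l # k # w)" for p k l w
      using q_symmetricD[OF u, of "i # p" k l w] by (simp add: coeff_cadjoint_creation)
  qed
next
  fix i j and u :: "'n fock"
  assume u: "u \<in> q_symmetric q"
  show "cadjoint (creation i) (cadjoint (creation j) u) =
      cnj (q i j) *\<^sub>C cadjoint (creation j) (cadjoint (creation i) u)"
    using q_symmetricD[OF u, of "[]" j i] by (intro ell2_eqI) (simp add: coeff_cadjoint_creation assms)
qed

text \<open>The adjoint $V_a^*$ strips a leading letter $a$ and preserves the subspace. Stripping the letters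
  before the two to be interchanged reduces the claim to the first two positions, where it is the
  commutation relation.\<close>
lemma q_commuting_subset_q_symmetric:
  fixes q :: "'n::finite \<Rightarrow> 'n \<Rightarrow> complex"
  assumes cnj: "\<And>i j. cnj (q i j) = q j i" and N: "is_q_commuting_on q creation N"
  shows "N \<subseteq> q_symmetric q"
proof
  fix u assume "u \<in> N"
  then have "coeff u (p @ j # i # w) = q j i * coeff u (p @ i # j # w)" for p i j w
  proof (induction p arbitrary: u)
    case Nil
    have "cadjoint (creation i) (cadjoint (creation j) u) =
        cnj (q i j) *\<^sub>C cadjoint (creation j) (cadjoint (creation i) u)"
      using N Nil unfolding is_q_commuting_on_def by blast
    from arg_cong[OF this, of "\<lambda>v. coeff v w"] show ?case
      by (simp add: coeff_cadjoint_creation cnj)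
  next
    case (Cons a p)
    have "cadjoint (creation a) u \<in> N" using N Cons.prems unfolding is_q_commuting_on_def by blast
    from Cons.IH[OF this] show ?case by (simp add: coeff_cadjoint_creation)
  qed
  then show "u \<in> q_symmetric q" by (rule q_symmetricI)
qed

lemma q_fock_eq:
  fixes q :: "'n::finite \<Rightarrow> 'n \<Rightarrow> complex"
  assumes "\<And>i j. cnj (q i j) = q j i"
  shows "q_fock q = q_symmetric q"
  unfolding q_fock_def max_q_commuting_def
proof (rule Greatest_equality)
  show "is_q_commuting_on q creation (q_symmetric q)"
    by (rule is_q_commuting_on_q_symmetric) (rule assms)
  show "N \<subseteq> q_symmetric q" if "is_q_commuting_on q creation N" for N
    using assms that by (rule q_commuting_subset_q_symmetric)
qed

theorem proposition11:
  fixes q :: "'n::finite \<Rightarrow> 'n \<Rightarrow> complex"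
  assumes "CARD('n) \<ge> 2"
    and "\<And>i j. cmod (q i j) = 1"
    and "\<And>i. q i i = 1"
    and "\<And>i j. q j i = inverse (q i j)"
  shows "hilbert_direct_sum (q_tensor_power q) = q_fock q"
proof -
  have nz: "q i j \<noteq> 0" for i j using assms(2)[of i j] by auto
  have "cnj (q i j) = q j i" for i j
  proof -
    have "q i j * cnj (q i j) = 1"
      using complex_norm_square[of "q i j"] assms(2)[of i j] by simp
    then have "inverse (q i j) = cnj (q i j)" by (rule inverse_unique)
    moreover have "q j i = inverse (q i j)" by (rule assms(4))
    ultimately show ?thesis by metis
  qed
  then have "q_fock q = q_symmetric q" by (rule q_fock_eq)
  moreover have "q_tensor_power q = (\<lambda>m. tensor_power m \<inter> q_symmetric q)"
    by (rule ext, rule q_tensor_power_eq) (rule nz assms(3,4))+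
  ultimately show ?thesis by (simp add: hilbert_direct_sum_q_symmetric)
qed

end
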